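(* Suppose that the objective functions $f_i$, $i\in\{1,\dots,q\}$, are convex. Let $u : [t_0,+\infty[ \to \mathcal H$ be a bounded trajectory of (IMOG) such that, for all $i\in\{1,\dots,q\}$, $$\gamma^2 > m L_i, \quad \text{where } L_i := \mathrm{Lip}(\nabla f_i; u([t_0,+\infty[)).$$ Then $u(t)$ converges weakly in $\mathcal H$, as $t\to+\infty$, to a weak Pareto optimum.
   Context: $\mathcal H$ is a real Hilbert space, $q\ge 1$ is an integer, and $f_i : \mathcal H \to \mathbb R$ ($i\in\{1,\dots,q\}$) are continuously differentiable functions whose gradients $\nabla f_i$ are Lipschitz continuous on bounded sets. $m>0$ and $\gamma>0$ are fixed real parameters. For $u\in\mathcal H$, let $\mathrm{co}\,\nabla f_i(u)$ denote the convex hull of $\{\nabla f_1(u),\dots,\nabla f_q(u)\}$. The vector field $s:\mathcal H\to\mathcal H$ is defined by letting $-s(u)$ be the element of minimal norm of $\mathrm{co}\,\nabla f_i(u)$. Given $t_0\in\mathbb R$, $T\in\,]t_0,+\infty]$ and $(u_0,\dot u_0)\in\mathcal H^2$, a solution (trajectory) of (IMOG) on $[t_0,T[$ is a function $u:[t_0,T[\to\mathcal H$ which is continuous on $[t_0,T[$, of class $C^2$ on $]t_0,T[$, and satisfies $$m\ddot u(t) = -\gamma\dot u(t)+s(u(t)) \text{ for all } t\in\,]t_0,T[,\qquad u(t_0)=u_0,\ \dot u(t_0)=\dot u_0$$ (derivatives at $t_0$ being right derivatives). For $\phi:\mathcal H\to\mathcal H$ and a nonempty $A\subset\mathcal H$,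 $\mathrm{Lip}(\phi;A):=\sup_{x\ne y\in A}\frac{\|\phi(x)-\phi(y)\|}{\|x-y\|}\in[0,+\infty]$. A point $u\in\mathcal H$ is a weak Pareto optimum if there is no $v\in\mathcal H$ with $f_i(v)<f_i(u)$ for all $i\in\{1,\dots,q\}$. *)

theory Defs
  imports "HOL-Analysis.Analysis"
begin

text \<open>
  A real Hilbert space is a type of sort \<open>{real_inner, complete_space}\<close>.  The objectives
  are \<open>f i\<close> for \<open>i \<in> {1..q}\<close>; values of \<open>f\<close> at other indices are never used.
\<close>

definition grad :: "('a::real_inner \<Rightarrow> real) \<Rightarrow> 'a \<Rightarrow> 'a" where
  "grad f u = (THE D. GDERIV f u :> D)"

definition continuously_differentiable :: "('a::real_inner \<Rightarrow> real) \<Rightarrow> bool" where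
  "continuously_differentiable f \<longleftrightarrow>
     (\<forall>u. GDERIV f u :> grad f u) \<and> continuous_on UNIV (grad f)"

definition lipschitz_on_bounded_sets :: "('a::metric_space \<Rightarrow> 'b::metric_space) \<Rightarrow> bool" where
  "lipschitz_on_bounded_sets \<phi> \<longleftrightarrow> (\<forall>B. bounded B \<longrightarrow> (\<exists>L. L-lipschitz_on B \<phi>))"

definition co_grad :: "nat \<Rightarrow> (nat \<Rightarrow> 'a::real_inner \<Rightarrow> real) \<Rightarrow> 'a \<Rightarrow> 'a set" where
  "co_grad q f u = convex hull ((\<lambda>i. grad (f i) u) ` {1..q})"

text \<open>The choice made by \<open>arg_min_on\<close> is harmless: see \<open>co_grad_minimal_norm\<close> below.\<close>

definition descent_field :: "nat \<Rightarrow> (nat \<Rightarrow> 'a::real_inner \<Rightarrow> real) \<Rightarrow> 'a \<Rightarrow> 'a" where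
  "descent_field q f u = - arg_min_on norm (co_grad q f u)"

text \<open>
  Only used for open \<open>S\<close>, so that the two-sided derivatives at points of \<open>S\<close> depend on the
  values of \<open>u\<close> on \<open>S\<close> alone.
\<close>

definition C2_differentiable_on :: "(real \<Rightarrow> 'a::real_normed_vector) \<Rightarrow> real set \<Rightarrow> bool" where
  "C2_differentiable_on u S \<longleftrightarrow>
     u C1_differentiable_on S \<and> (\<lambda>t. vector_derivative u (at t)) C1_differentiable_on S"

text \<open>
  A trajectory on \<open>[t0, T[\<close> is represented by a function on all of \<open>real\<close> whose values outside
  that interval play no role.
\<close>

definition IMOG_solution ::
  "real \<Rightarrow> real \<Rightarrow> nat \<Rightarrow> (nat \<Rightarrow> 'a::real_inner \<Rightarrow> real) \<Rightarrow>
   real \<Rightarrow> ereal \<Rightarrow> 'a \<Rightarrow> 'a \<Rightarrow> (real \<Rightarrow> 'a) \<Rightarrow> bool" where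
  "IMOG_solution m \<gamma> q f t0 T u0 v0 u \<longleftrightarrow>
     ereal t0 < T \<and>
     continuous_on {t. t0 \<le> t \<and> ereal t < T} u \<and>
     C2_differentiable_on u {t. t0 < t \<and> ereal t < T} \<and>
     (\<forall>t. t0 < t \<and> ereal t < T \<longrightarrow>
        m *\<^sub>R vector_derivative (\<lambda>r. vector_derivative u (at r)) (at t) =
        - \<gamma> *\<^sub>R vector_derivative u (at t) + descent_field q f (u t)) \<and>
     u t0 = u0 \<and> (u has_vector_derivative v0) (at_right t0)"

text \<open>
  In \<open>ennreal\<close> the supremum of the empty set is \<open>0\<close>, so \<open>Lip \<phi> {x} = 0\<close>.
\<close>

definition Lip :: "('a::real_normed_vector \<Rightarrow> 'b::real_normed_vector) \<Rightarrow> 'a set \<Rightarrow> ennreal" where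
  "Lip \<phi> A = (SUP (x, y) \<in> {(x, y). x \<in> A \<and> y \<in> A \<and> x \<noteq> y}.
                ennreal (norm (\<phi> x - \<phi> y) / norm (x - y)))"

definition weak_pareto_optimum :: "nat \<Rightarrow> (nat \<Rightarrow> 'a \<Rightarrow> real) \<Rightarrow> 'a \<Rightarrow> bool" where
  "weak_pareto_optimum q f u \<longleftrightarrow> \<not> (\<exists>v. \<forall>i\<in>{1..q}. f i v < f i u)"

definition converges_weakly ::
  "('b \<Rightarrow> 'a::real_normed_vector) \<Rightarrow> 'a \<Rightarrow> 'b filter \<Rightarrow> bool" where
  "converges_weakly u l F \<longleftrightarrow>
     (\<forall>\<phi>::'a \<Rightarrow> real. bounded_linear \<phi> \<longrightarrow> ((\<lambda>t. \<phi> (u t)) \<longlongrightarrow> \<phi> l) F)"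

lemma grad_eqI:
  assumes "GDERIV f u :> D"
  shows "grad f u = D"
  unfolding grad_def
proof (rule the_equality)
  fix E assume "GDERIV f u :> E"
  with assms have "(\<lambda>h. inner h D) = (\<lambda>h. inner h E)"
    unfolding gderiv_def by (rule has_derivative_unique)
  then have "inner h (D - E) = 0" for h
    by (metis inner_diff_right right_minus_eq)
  then show "E = D"
    by (metis inner_eq_zero_iff right_minus_eq)
qed (fact assms)

lemma co_grad_minimal_norm:
  fixes f :: "nat \<Rightarrow> 'a::real_inner \<Rightarrow> real"
  assumes "q \<ge> 1"
  shows "\<exists>!v. is_arg_min norm (\<lambda>v. v \<in> co_grad q f u) v"
proof -
  have ne: "co_grad q f u \<noteq> {}"
    using assms by (auto simp: co_grad_def)
  have "compact (co_grad q f u)"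
    unfolding co_grad_def by (intro finite_imp_compact_convex_hull) simp
  then obtain v where v: "v \<in> co_grad q f u" "\<And>w. w \<in> co_grad q f u \<Longrightarrow> norm v \<le> norm w"
    using continuous_attains_inf[OF _ ne, of norm] by (metis continuous_on_norm_id)
  have "w = v" if w: "w \<in> co_grad q f u" "\<And>z. z \<in> co_grad q f u \<Longrightarrow> norm w \<le> norm z" for w
  proof -
    have eq: "norm w = norm v" using v w by (simp add: order_antisym)
    have "convex (co_grad q f u)" by (simp add: co_grad_def)
    then have "(1/2) *\<^sub>R v + (1/2) *\<^sub>R w \<in> co_grad q f u"
      using v(1) w(1) by (rule convexD) auto
    then have "norm v \<le> norm ((1/2) *\<^sub>R (v + w))"
      using v(2) by (metis scaleR_right_distrib)
    then have "2 * norm v \<le> norm (v + w)" by simp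
    then have "(2 * norm v)\<^sup>2 \<le> (norm (v + w))\<^sup>2" by (intro power_mono) auto
    moreover have "(norm (v + w))\<^sup>2 + (norm (v - w))\<^sup>2 = 2 * (norm v)\<^sup>2 + 2 * (norm w)\<^sup>2"
      by (simp add: power2_norm_eq_inner inner_add inner_diff inner_commute)
    ultimately have "(norm (v - w))\<^sup>2 \<le> 0"
      unfolding eq by (simp only: power_mult_distrib power2_eq_square[of "2::real"])
    then show ?thesis by simp
  qed
  then show ?thesis
    using v unfolding is_arg_min_linorder by metis
qed

end

theory Submission
  imports Defs
begin

text \<open>
  Write \<open>v\<close> and \<open>a\<close> for velocity and acceleration along the trajectory, so that
  \<open>s(u) = m a + \<gamma> v\<close>.  Since \<open>-s(u)\<close> is the projection of \<open>0\<close> onto the convex hull of the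
  gradients, \<open>\<langle>\<nabla>f\<^sub>i(u), s(u)\<rangle> \<le> -\<parallel>s(u)\<parallel>\<^sup>2\<close> for every \<open>i\<close>.  Expanding both sides in \<open>v\<close> and \<open>a\<close> and
  using the Lipschitz constant to control how fast \<open>\<nabla>f\<^sub>i(u(t))\<close> varies shows that

    \<open>W\<^sub>i = \<gamma> f\<^sub>i(u) + m \<langle>\<nabla>f\<^sub>i(u), v\<rangle> + m \<gamma> \<parallel>v\<parallel>\<^sup>2\<close>

  decreases at rate at least \<open>m\<^sup>2 \<parallel>a\<parallel>\<^sup>2 + (\<gamma>\<^sup>2 - m L\<^sub>i) \<parallel>v\<parallel>\<^sup>2\<close> (lemma \<open>upper_dini_energy\<close>).  The
  trajectory is bounded, so \<open>W\<^sub>i\<close> is bounded below and converges.  This forces \<open>v \<longlongrightarrow> 0\<close>, hence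
  \<open>f\<^sub>i(u(t))\<close> converges to a limit \<open>f\<^sub>i\<^sup>*\<close>, and \<open>\<gamma> f\<^sub>i\<^sup>* \<le> W\<^sub>i\<close> throughout.

  Now let \<open>z\<close> satisfy \<open>f\<^sub>i(z) \<le> f\<^sub>i\<^sup>* - d\<close> for all \<open>i\<close>.  By convexity of the \<open>f\<^sub>i\<close>, the function

    \<open>m \<langle>u - z, v\<rangle> + (\<gamma>/2) \<parallel>u - z\<parallel>\<^sup>2 + (m\<^sup>2/2\<gamma>) \<parallel>v\<parallel>\<^sup>2 + m W\<^sub>1 / (\<gamma>\<^sup>2 - m L\<^sub>1)\<close>

  decreases at rate at least \<open>d\<close> (lemma \<open>upper_dini_anchored_energy\<close>), and it is bounded below.
  With \<open>d = 0\<close> this makes \<open>\<parallel>u(t) - z\<parallel>\<close> converge; with \<open>d > 0\<close> it is impossible, so no point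
  is below all the limits \<open>f\<^sub>i\<^sup>*\<close> by a uniform margin.

  Finally, consider the points that lie in the closed convex hull of every tail of the trajectory.
  At each of them \<open>f\<^sub>i \<le> f\<^sub>i\<^sup>*\<close>, because sublevel sets of \<open>f\<^sub>i\<close> are closed and convex; so the
  trajectory's distance to each of them converges, and the argument of Opial's lemma
  (\<open>converges_weakly_if_distances_converge\<close>) gives weak convergence to a point \<open>p\<close> of this kind.
  A point strictly better than \<open>p\<close> in every objective would be below every \<open>f\<^sub>i\<^sup>*\<close> by a uniform
  margin, so \<open>p\<close> is a weak Pareto optimum.
\<close>

section \<open>Upper right Dini derivatives and monotonicity\<close>

text \<open>
  The upper right Dini derivative of \<open>F\<close> at \<open>t\<close> is at most \<open>r\<close>.  The energies below contain
  \<open>\<nabla>f\<^sub>i(u(t))\<close>, which is only Lipschitz in \<open>t\<close>: they need not be differentiable, and this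
  one-sided bound replaces the derivative.
\<close>

definition upper_dini_le :: "(real \<Rightarrow> real) \<Rightarrow> real \<Rightarrow> real \<Rightarrow> bool" where
  "upper_dini_le F t r \<longleftrightarrow> (\<forall>e>0. \<forall>\<^sub>F s in at_right t. F s \<le> F t + (r + e) * (s - t))"

lemma upper_dini_leI:
  assumes "(Q \<longlongrightarrow> r) (at_right t)"
    and "\<And>s. s > t \<Longrightarrow> F s - F t \<le> (s - t) * Q s"
  shows "upper_dini_le F t r"
  unfolding upper_dini_le_def
proof (intro allI impI)
  fix e :: real assume "e > 0"
  then have "\<forall>\<^sub>F s in at_right t. Q s < r + e"
    using assms(1) by (intro order_tendstoD) auto
  then show "\<forall>\<^sub>F s in at_right t. F s \<le> F t + (r + e) * (s - t)"
    using eventually_at_right_less[of t]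
  proof eventually_elim
    case (elim s)
    then have "(s - t) * Q s \<le> (s - t) * (r + e)"
      by (intro mult_left_mono) auto
    moreover have "F s - F t \<le> (s - t) * Q s"
      using elim by (intro assms(2))
    ultimately have "F s - F t \<le> (s - t) * (r + e)" by linarith
    then show ?case by (simp add: mult.commute)
  qed
qed

lemma has_derivative_upper_dini_le:
  assumes "(F has_real_derivative r) (at t)"
  shows "upper_dini_le F t r"
proof (rule upper_dini_leI)
  show "((\<lambda>s. (F s - F t) / (s - t)) \<longlongrightarrow> r) (at_right t)"
    using assms unfolding has_field_derivative_iff
    by (rule filterlim_mono) (auto simp: at_le)
qed simp

lemma upper_dini_le_mono:
  assumes "upper_dini_le F t r" "r \<le> r'"
  shows "upper_dini_le F t r'"
  unfolding upper_dini_le_def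
proof (intro allI impI)
  fix e :: real assume "e > 0"
  then have "\<forall>\<^sub>F s in at_right t. F s \<le> F t + (r + e) * (s - t)"
    using assms(1) by (simp add: upper_dini_le_def)
  then show "\<forall>\<^sub>F s in at_right t. F s \<le> F t + (r' + e) * (s - t)"
    using eventually_at_right_less[of t]
  proof eventually_elim
    case (elim s)
    have "(r + e) * (s - t) \<le> (r' + e) * (s - t)"
      using elim assms(2) by (intro mult_right_mono) auto
    with elim show ?case by linarith
  qed
qed

lemma upper_dini_le_add:
  assumes "upper_dini_le F t r" "upper_dini_le G t r'"
  shows "upper_dini_le (\<lambda>s. F s + G s) t (r + r')"
  unfolding upper_dini_le_def
proof (intro allI impI)
  fix e :: real assume "e > 0"
  then have "\<forall>\<^sub>F s in at_right t. F s \<le> F t + (r + e/2) * (s - t)"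
    "\<forall>\<^sub>F s in at_right t. G s \<le> G t + (r' + e/2) * (s - t)"
    using assms by (simp_all add: upper_dini_le_def)
  then show "\<forall>\<^sub>F s in at_right t. F s + G s \<le> F t + G t + (r + r' + e) * (s - t)"
    by eventually_elim (auto simp: field_simps)
qed

lemma upper_dini_le_cmult:
  assumes "upper_dini_le F t r" "c > 0"
  shows "upper_dini_le (\<lambda>s. c * F s) t (c * r)"
  unfolding upper_dini_le_def
proof (intro allI impI)
  fix e :: real assume "e > 0"
  then have "\<forall>\<^sub>F s in at_right t. F s \<le> F t + (r + e / c) * (s - t)"
    using assms by (simp add: upper_dini_le_def)
  then show "\<forall>\<^sub>F s in at_right t. c * F s \<le> c * F t + (c * r + e) * (s - t)"
  proof eventually_elim
    case (elim s)
    then have "c * F s \<le> c * (F t + (r + e / c) * (s - t))"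
      using assms(2) by (intro mult_left_mono) auto
    also have "\<dots> = c * F t + (c * r + e) * (s - t)"
      using assms(2) by (simp add: field_simps)
    finally show ?case .
  qed
qed

text \<open>
  For every \<open>e > 0\<close> the line of slope \<open>r + e\<close> through \<open>(a, F a)\<close> cannot be crossed: the last time
  at which \<open>F\<close> is below it is \<open>b\<close>, since before \<open>b\<close> the Dini bound extends the estimate a
  little to the right.
\<close>

lemma upper_dini_le_imp_le:
  fixes F :: "real \<Rightarrow> real"
  assumes ab: "a \<le> b" and cont: "continuous_on {a..b} F"
    and dini: "\<And>t. a \<le> t \<Longrightarrow> t < b \<Longrightarrow> upper_dini_le F t r"
  shows "F b \<le> F a + r * (b - a)"
proof -
  have *: "F b \<le> F a + (r + e) * (b - a)" if e: "e > 0" for e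
  proof -
    define X where "X = {s \<in> {a..b}. F s \<le> F a + (r + e) * (s - a)}"
    have "continuous_on {a..b} (\<lambda>s. F s - (F a + (r + e) * (s - a)))"
      by (intro continuous_intros cont)
    then have "closed ({a..b} \<inter> (\<lambda>s. F s - (F a + (r + e) * (s - a))) -` {..0})"
      by (intro continuous_closed_preimage) auto
    moreover have "{a..b} \<inter> (\<lambda>s. F s - (F a + (r + e) * (s - a))) -` {..0} = X"
      by (auto simp: X_def)
    ultimately have cl: "closed X" by simp
    have ne: "X \<noteq> {}" and bdd: "bdd_above X"
      using ab by (auto simp: X_def intro: bdd_aboveI[of _ b])
    define c where "c = Sup X"
    have c: "c \<in> X" unfolding c_def by (rule closed_contains_Sup[OF ne bdd cl])
    have "c = b"
    proof (rule ccontr)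
      assume "c \<noteq> b"
      then have "a \<le> c" "c < b" using c by (auto simp: X_def)
      then have "\<forall>\<^sub>F s in at_right c. F s \<le> F c + (r + e) * (s - c)"
        using dini e by (simp add: upper_dini_le_def)
      moreover have "\<forall>\<^sub>F s in at_right c. s \<in> {c<..<b}"
        using \<open>c < b\<close> by (rule eventually_at_right_real)
      ultimately have "\<forall>\<^sub>F s in at_right c. s \<in> X \<and> c < s"
      proof eventually_elim
        case (elim s)
        then show ?case using c by (auto simp: X_def algebra_simps)
      qed
      then obtain s where "s \<in> X" "c < s"
        using eventually_happens[of _ "at_right c"] by (auto simp: trivial_limit_at_right_real)
      then show False using cSup_upper[OF _ bdd, of s] by (simp add: c_def)
    qed
    then show ?thesis using c by (simp add: X_def)
  qed
  show ?thesis
  proof (cases "a = b")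
    case False
    show ?thesis
    proof (rule field_le_epsilon)
      fix e :: real assume "e > 0"
      then show "F b \<le> F a + r * (b - a) + e"
        using *[of "e / (b - a)"] ab False by (simp add: distrib_right)
    qed
  qed simp
qed

lemma converges_if_upper_dini_le_0:
  fixes F :: "real \<Rightarrow> real"
  assumes cont: "continuous_on {a<..} F"
    and dini: "\<And>t. t > a \<Longrightarrow> upper_dini_le F t 0"
    and bound: "\<And>t. t > a \<Longrightarrow> B \<le> F t"
  obtains l where "(F \<longlongrightarrow> l) at_top" "\<And>t. t > a \<Longrightarrow> l \<le> F t"
proof
  let ?l = "Inf (F ` {a<..})"
  have bdd: "bdd_below (F ` {a<..})" using bound by (auto intro: bdd_belowI[of _ B])
  show low: "?l \<le> F t" if "t > a" for t
    using that bdd by (auto intro: cInf_lower)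
  have antimono: "F t \<le> F s" if "a < s" "s \<le> t" for s t
    using upper_dini_le_imp_le[of s t F 0] that dini
      continuous_on_subset[OF cont, of "{s..t}"] by fastforce
  show "(F \<longlongrightarrow> ?l) at_top"
  proof (rule decreasing_tendsto)
    show "\<forall>\<^sub>F t in at_top. ?l \<le> F t"
      using eventually_gt_at_top[of a] by eventually_elim (rule low)
    fix x assume "?l < x"
    then obtain s where "s > a" "F s < x"
      using bdd cInf_less_iff[of "F ` {a<..}" x] by auto
    then show "\<forall>\<^sub>F t in at_top. F t < x"
      using eventually_ge_at_top[of s] antimono
      by (metis (mono_tags, lifting) eventually_mono order_le_less_trans)
  qed
qed

lemma unbounded_below_if_upper_dini_le_neg:
  fixes F :: "real \<Rightarrow> real"
  assumes cont: "continuous_on {a<..} F"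
    and dini: "\<And>t. t > a \<Longrightarrow> upper_dini_le F t (- d)" and "d > 0"
    and bound: "\<And>t. t > a \<Longrightarrow> B \<le> F t"
  shows False
proof -
  define b where "b = a + 1 + (\<bar>F (a + 1) - B\<bar> + 1) / d"
  have "a + 1 \<le> b" using \<open>d > 0\<close> by (simp add: b_def)
  then have "F b \<le> F (a + 1) + - d * (b - (a + 1))"
    using dini continuous_on_subset[OF cont, of "{a+1..b}"]
    by (intro upper_dini_le_imp_le) (auto simp: subset_eq)
  also have "\<dots> < B" using \<open>d > 0\<close> by (simp add: b_def)
  also have "\<dots> \<le> F b" using bound \<open>a + 1 \<le> b\<close> by simp
  finally show False by simp
qed

section \<open>Nested convex sets and weak convergence in Hilbert space\<close>

text \<open>
  This substitutes for weak sequential compactness of bounded sets.  The distances \<open>d n\<close> from \<open>0\<close>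
  to \<open>C n\<close> increase to a finite limit, and by the parallelogram law points of \<open>C n\<close> of nearly
  minimal norm form a Cauchy sequence; its limit lies in all the \<open>C n\<close>.
\<close>

lemma nested_closed_convex_Inter_nonempty:
  fixes C :: "nat \<Rightarrow> 'a::{real_inner, complete_space} set"
  assumes closed: "\<And>n. closed (C n)" and convex: "\<And>n. convex (C n)"
    and ne: "\<And>n. C n \<noteq> {}" and "bounded (C 0)" and dec: "decseq C"
  obtains x where "\<And>n. x \<in> C n"
proof -
  obtain R where R: "\<And>x. x \<in> C 0 \<Longrightarrow> norm x \<le> R"
    using \<open>bounded (C 0)\<close> by (auto simp: bounded_iff)
  define d where "d n = Inf (norm ` C n)" for n
  have bdd: "bdd_below (norm ` C n)" for n by (auto intro: bdd_belowI[of _ 0])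
  have d_le: "d n \<le> norm x" if "x \<in> C n" for n x
    unfolding d_def using bdd that by (auto intro: cInf_lower)
  have d_ge0: "0 \<le> d n" for n
    unfolding d_def using ne by (auto intro: cInf_greatest)
  have "\<exists>x\<in>C n. norm x < d n + 1 / Suc n" for n
    using cInf_less_iff[of "norm ` C n" "d n + 1 / Suc n"] bdd[of n] ne[of n]
    by (auto simp: d_def)
  then obtain x where x: "\<And>n. x n \<in> C n" "\<And>n. norm (x n) < d n + 1 / Suc n"
    by metis
  have sub: "C k \<subseteq> C n" if "n \<le> k" for n k
    using dec that by (auto simp: decseq_def)
  have "incseq d"
    unfolding incseq_def d_def using ne bdd sub
    by (intro allI impI cInf_superset_mono image_mono) auto
  moreover have "d n \<le> R" for n
    using d_le[OF x(1)[of n]] R[of "x n"] sub[of 0 n] x(1)[of n] by auto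
  ultimately obtain D where D: "d \<longlonglongrightarrow> D" "\<And>n. d n \<le> D"
    by (metis incseq_convergent)
  have "Cauchy x"
  proof (rule metric_CauchyI)
    fix e :: real assume "e > 0"
    have "(\<lambda>n. 4 * (D + 1 / Suc n)\<^sup>2 - 4 * (d n)\<^sup>2) \<longlonglongrightarrow> 4 * (D + 0)\<^sup>2 - 4 * D\<^sup>2"
      by (intro tendsto_intros D(1) LIMSEQ_inverse_real_of_nat[unfolded inverse_eq_divide])
    then have "\<forall>\<^sub>F n in sequentially. 4 * (D + 1 / Suc n)\<^sup>2 - 4 * (d n)\<^sup>2 < e\<^sup>2"
      using \<open>e > 0\<close> by (intro order_tendstoD) auto
    then obtain N where N: "4 * (D + 1 / Suc N)\<^sup>2 - 4 * (d N)\<^sup>2 < e\<^sup>2"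
      by (auto simp: eventually_sequentially)
    have "dist (x n) (x k) < e" if "N \<le> n" "N \<le> k" for n k
    proof -
      have le: "(norm (x j))\<^sup>2 \<le> (D + 1 / Suc N)\<^sup>2" if "N \<le> j" for j
      proof (rule power_mono)
        have "1 / real (Suc j) \<le> 1 / real (Suc N)"
          using that by (intro divide_left_mono) auto
        then show "norm (x j) \<le> D + 1 / Suc N" using x(2)[of j] D(2)[of j] by linarith
      qed simp
      have "(1/2) *\<^sub>R x n + (1/2) *\<^sub>R x k \<in> C N"
        using convex[of N] x(1) sub[OF that(1)] sub[OF that(2)]
        by (intro convexD) auto
      then have "d N \<le> norm ((1/2) *\<^sub>R (x n + x k))"
        using d_le by (metis scaleR_right_distrib)
      then have "2 * d N \<le> norm (x n + x k)" by simp
      then have "(2 * d N)\<^sup>2 \<le> (norm (x n + x k))\<^sup>2"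
        using d_ge0 by (intro power_mono) auto
      moreover have "(norm (x n + x k))\<^sup>2 + (norm (x n - x k))\<^sup>2
          = 2 * (norm (x n))\<^sup>2 + 2 * (norm (x k))\<^sup>2"
        by (simp add: power2_norm_eq_inner inner_add inner_diff inner_commute)
      ultimately have "(norm (x n - x k))\<^sup>2 < e\<^sup>2"
        using N le[OF that(1)] le[OF that(2)] by (simp add: power_mult_distrib)
      then show ?thesis
        using \<open>e > 0\<close> by (simp add: dist_norm power_less_imp_less_base)
    qed
    then show "\<exists>M. \<forall>m\<ge>M. \<forall>n\<ge>M. dist (x m) (x n) < e" by blast
  qed
  then obtain l where l: "x \<longlonglongrightarrow> l" by (auto simp: Cauchy_convergent_iff convergent_def)
  have "l \<in> C n" for n
  proof (rule Lim_in_closed_set[OF closed _ _ l])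
    show "\<forall>\<^sub>F k in sequentially. x k \<in> C n"
      using eventually_ge_at_top[of n] by eventually_elim (use x(1) sub in blast)
  qed simp
  then show thesis using that by blast
qed

text \<open>
  In a Hilbert space this is the closed convex hull of the weak cluster points of a bounded \<open>u\<close>.
\<close>

definition asymptotic_hull :: "(real \<Rightarrow> 'a::real_normed_vector) \<Rightarrow> 'a set" where
  "asymptotic_hull u = (\<Inter>T. closure (convex hull (u ` {T..})))"

lemma asymptotic_hull_subset:
  assumes "closed H" "convex H" "\<forall>\<^sub>F t in at_top. u t \<in> H"
  shows "asymptotic_hull u \<subseteq> H"
proof -
  obtain T where "\<And>t. t \<ge> T \<Longrightarrow> u t \<in> H"
    using assms(3) by (auto simp: eventually_at_top_linorder)
  then have "closure (convex hull (u ` {T..})) \<subseteq> H"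
    using assms by (intro closure_minimal hull_minimal) auto
  then show ?thesis by (auto simp: asymptotic_hull_def)
qed

text \<open>
  The role of a weakly convergent subsequence: a closed convex set that \<open>u\<close> visits at arbitrarily
  late times contains a point of the asymptotic hull, found in the nested closed convex hulls of
  the late visits.
\<close>

lemma asymptotic_hull_meets:
  fixes u :: "real \<Rightarrow> 'a::{real_inner, complete_space}"
  assumes bdd: "bounded (u ` {t0<..})" and H: "closed H" "convex H"
    and freq: "\<exists>\<^sub>F t in at_top. u t \<in> H"
  shows "asymptotic_hull u \<inter> H \<noteq> {}"
proof -
  define A where "A T = u ` {t. T \<le> t \<and> u t \<in> H}" for T
  define C where "C n = closure (convex hull A (t0 + 1 + real n))" for n :: nat
  have ne: "A T \<noteq> {}" for T
    using freq by (auto simp: A_def frequently_def eventually_at_top_linorder)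
  have mono: "A T \<subseteq> A T'" if "T' \<le> T" for T T' using that by (auto simp: A_def)
  obtain p where p: "\<And>n. p \<in> C n"
  proof (rule nested_closed_convex_Inter_nonempty[of C])
    show "closed (C n)" "convex (C n)" "C n \<noteq> {}" for n
      using ne by (auto simp: C_def convex_closure)
    have "bounded (A (t0 + 1))"
      by (rule bounded_subset[OF bdd]) (auto simp: A_def)
    then show "bounded (C 0)"
      by (simp add: C_def bounded_convex_hull bounded_closure)
    show "decseq C"
      unfolding decseq_def C_def by (intro allI impI closure_mono hull_mono mono) auto
  qed blast
  have "p \<in> closure (convex hull (u ` {T..}))" for T
  proof -
    obtain n :: nat where "T - t0 - 1 \<le> n" using real_arch_simple by blast
    then have "C n \<subseteq> closure (convex hull (u ` {T..}))"
      unfolding C_def by (intro closure_mono hull_mono) (auto simp: A_def)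
    then show ?thesis using p by blast
  qed
  moreover have "C 0 \<subseteq> H"
    unfolding C_def using H by (intro closure_minimal hull_minimal) (auto simp: A_def)
  ultimately have "p \<in> asymptotic_hull u \<inter> H"
    using p[of 0] by (simp add: asymptotic_hull_def subset_iff)
  then show ?thesis by blast
qed

text \<open>
  A version of Opial's lemma.  If the distances to \<open>p\<close> and \<open>z\<close> converge, then so does
  \<open>\<langle>z - p, u(t)\<rangle>\<close>.  The limit is the value of the functional \<open>\<langle>z - p, \<cdot>\<rangle>\<close> at every point of
  the asymptotic hull; as it is the same at \<open>z\<close> and at \<open>p\<close>, the hull is a single point.
  A functional that stayed away from its value there at arbitrarily late times would, by
  \<open>asymptotic_hull_meets\<close>, produce a second one.
\<close>

lemma converges_weakly_if_distances_converge:
  fixes u :: "real \<Rightarrow> 'a::{real_inner, complete_space}"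
  assumes bdd: "bounded (u ` {t0<..})"
    and dist: "\<And>z. z \<in> asymptotic_hull u \<Longrightarrow> \<exists>l. ((\<lambda>t. (norm (u t - z))\<^sup>2) \<longlongrightarrow> l) at_top"
  obtains p where "p \<in> asymptotic_hull u" "converges_weakly u p at_top"
proof -
  obtain p where p: "p \<in> asymptotic_hull u"
    using asymptotic_hull_meets[OF bdd, of UNIV] by auto
  have unique: "z = p" if z: "z \<in> asymptotic_hull u" for z
  proof -
    obtain k l where "((\<lambda>t. (norm (u t - p))\<^sup>2) \<longlongrightarrow> k) at_top"
        "((\<lambda>t. (norm (u t - z))\<^sup>2) \<longlongrightarrow> l) at_top"
      using dist p z by metis
    then have "((\<lambda>t. ((norm (u t - p))\<^sup>2 - (norm (u t - z))\<^sup>2 - (norm p)\<^sup>2 + (norm z)\<^sup>2) / 2)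
        \<longlongrightarrow> (k - l - (norm p)\<^sup>2 + (norm z)\<^sup>2) / 2) at_top"
      by (intro tendsto_intros) auto
    moreover have "((norm (u t - p))\<^sup>2 - (norm (u t - z))\<^sup>2 - (norm p)\<^sup>2 + (norm z)\<^sup>2) / 2
        = inner (z - p) (u t)" for t
      by (simp add: power2_norm_eq_inner inner_add inner_diff inner_commute)
    ultimately obtain c where c: "((\<lambda>t. inner (z - p) (u t)) \<longlongrightarrow> c) at_top" by auto
    have val: "inner (z - p) x = c" if x: "x \<in> asymptotic_hull u" for x
    proof (rule antisym; rule field_le_epsilon)
      fix e :: real assume "e > 0"
      then have "\<forall>\<^sub>F t in at_top. u t \<in> {y. inner (z - p) y \<le> c + e}"
        using order_tendstoD(2)[OF c, of "c + e"] by (auto elim: eventually_mono)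
      then show "inner (z - p) x \<le> c + e"
        using asymptotic_hull_subset[OF closed_halfspace_le convex_halfspace_le] x by blast
    next
      fix e :: real assume "e > 0"
      then have "\<forall>\<^sub>F t in at_top. u t \<in> {y. inner (z - p) y \<ge> c - e}"
        using order_tendstoD(1)[OF c, of "c - e"] by (auto elim: eventually_mono)
      then show "c \<le> inner (z - p) x + e"
        using asymptotic_hull_subset[OF closed_halfspace_ge convex_halfspace_ge] x by fastforce
    qed
    have "inner (z - p) (z - p) = 0"
      using val[OF z] val[OF p] by (simp add: inner_diff_right)
    then show ?thesis by simp
  qed
  have upper: "\<forall>\<^sub>F t in at_top. \<phi> (u t) < \<phi> p + e"
    if \<phi>: "bounded_linear \<phi>" and "e > 0" for \<phi> :: "'a \<Rightarrow> real" and e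
  proof (rule ccontr)
    interpret bounded_linear \<phi> by fact
    assume "\<not> ?thesis"
    then have "\<exists>\<^sub>F t in at_top. u t \<in> \<phi> -` {\<phi> p + e..}"
      by (simp add: frequently_def not_le)
    moreover have "closed (\<phi> -` {\<phi> p + e..})"
      by (intro closed_vimage continuous_on) (auto intro: continuous_intros)
    moreover have "convex (\<phi> -` {\<phi> p + e..})"
      by (intro convex_linear_vimage linear_axioms) auto
    ultimately have "asymptotic_hull u \<inter> \<phi> -` {\<phi> p + e..} \<noteq> {}"
      by (intro asymptotic_hull_meets[OF bdd])
    then show False using unique \<open>e > 0\<close> by auto
  qed
  have "converges_weakly u p at_top"
    unfolding converges_weakly_def
  proof (intro allI impI order_tendstoI)
    fix \<phi> :: "'a \<Rightarrow> real" and b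
    assume \<phi>: "bounded_linear \<phi>"
    show "\<forall>\<^sub>F t in at_top. \<phi> (u t) < b" if "\<phi> p < b"
      using upper[OF \<phi>, of "b - \<phi> p"] that by simp
    show "\<forall>\<^sub>F t in at_top. b < \<phi> (u t)" if "b < \<phi> p"
      using upper[OF bounded_linear_minus[OF \<phi>], of "\<phi> p - b"] that by simp
  qed
  then show thesis using p that by blast
qed

section \<open>Gradients and the steepest descent field\<close>

lemma convex_above_tangent:
  fixes f :: "'a::real_inner \<Rightarrow> real"
  assumes conv: "convex_on UNIV f" and deriv: "GDERIV f x :> D"
  shows "f x + inner D (z - x) \<le> f z"
proof -
  define g where "g t = f (x + t *\<^sub>R (z - x))" for t :: real
  have "(g has_derivative (\<lambda>t. inner (t *\<^sub>R (z - x)) D)) (at 0)"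
    unfolding g_def
    by (rule has_derivative_compose[where f="\<lambda>t. x + t *\<^sub>R (z - x)" and g=f])
      (use deriv in \<open>auto simp: gderiv_def intro!: derivative_eq_intros\<close>)
  then have "(g has_real_derivative inner D (z - x)) (at 0)"
    unfolding has_field_derivative_def
    by (rule has_derivative_eq_rhs) (simp add: fun_eq_iff inner_commute mult.commute)
  then have "((\<lambda>t. (g t - g 0) / t) \<longlongrightarrow> inner D (z - x)) (at_right 0)"
    unfolding has_field_derivative_iff
    by (auto intro: tendsto_within_subset)
  moreover have "\<forall>\<^sub>F t in at_right 0. (g t - g 0) / t \<le> f z - f x"
    using eventually_at_right_real[of 0 1, OF zero_less_one]
  proof eventually_elim
    case (elim t)
    then have "f ((1 - t) *\<^sub>R x + t *\<^sub>R z) \<le> (1 - t) * f x + t * f z"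
      using conv by (intro convex_onD) auto
    moreover have "(1 - t) *\<^sub>R x + t *\<^sub>R z = x + t *\<^sub>R (z - x)"
      by (simp add: algebra_simps)
    ultimately have "g t - g 0 \<le> (f z - f x) * t"
      by (simp add: g_def algebra_simps)
    then show ?case using elim by (simp add: pos_divide_le_eq)
  qed
  ultimately have "inner D (z - x) \<le> f z - f x"
    by (intro tendsto_upperbound) auto
  then show ?thesis by simp
qed

lemma convex_on_sublevel:
  assumes "convex_on UNIV f"
  shows "convex {x. f x \<le> c}"
  unfolding convex_alt
proof (intro ballI allI impI; elim CollectE conjE; rule CollectI)
  fix x y and t :: real
  assume "f x \<le> c" "f y \<le> c" "0 \<le> t" "t \<le> 1"
  then have "f ((1 - t) *\<^sub>R x + t *\<^sub>R y) \<le> (1 - t) * f x + t * f y"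
    using assms by (intro convex_onD) auto
  also have "\<dots> \<le> (1 - t) * c + t * c"
    using \<open>f x \<le> c\<close> \<open>f y \<le> c\<close> \<open>0 \<le> t\<close> \<open>t \<le> 1\<close> by (intro add_mono mult_left_mono) auto
  finally show "f ((1 - t) *\<^sub>R x + t *\<^sub>R y) \<le> c" by (simp add: algebra_simps)
qed

lemma minus_descent_field:
  assumes "q \<ge> 1"
  shows "- descent_field q f x \<in> co_grad q f x"
    and "y \<in> co_grad q f x \<Longrightarrow> norm (descent_field q f x) \<le> norm y"
proof -
  have "\<exists>v. is_arg_min norm (\<lambda>v. v \<in> co_grad q f x) v"
    using co_grad_minimal_norm[OF assms, of f x] by blast
  then have "is_arg_min norm (\<lambda>v. v \<in> co_grad q f x) (- descent_field q f x)"
    unfolding descent_field_def arg_min_on_def arg_min_def by (simp add: someI_ex)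
  then show "- descent_field q f x \<in> co_grad q f x"
    and "y \<in> co_grad q f x \<Longrightarrow> norm (descent_field q f x) \<le> norm y"
    by (auto simp: is_arg_min_linorder)
qed

text \<open>
  The variational inequality for the projection of \<open>0\<close> onto the convex hull of the gradients:
  \<open>s\<close> is a common descent direction.
\<close>

lemma inner_grad_descent_field_le:
  assumes "i \<in> {1..q}"
  shows "inner (grad (f i) x) (descent_field q f x) \<le> - (norm (descent_field q f x))\<^sup>2"
proof -
  have q: "q \<ge> 1" using assms by simp
  let ?s = "descent_field q f x"
  have g: "grad (f i) x \<in> co_grad q f x"
    using assms by (auto simp: co_grad_def intro: hull_inc)
  have "inner (0 - (- ?s)) (grad (f i) x - (- ?s)) \<le> 0"
  proof (rule any_closest_point_dot[where S="co_grad q f x"])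
    show "closed (co_grad q f x)"
      unfolding co_grad_def by (intro compact_imp_closed finite_imp_compact_convex_hull) simp
  qed (use g minus_descent_field[OF q, where f=f and x=x] in \<open>auto simp: co_grad_def\<close>)
  then show ?thesis
    by (simp add: inner_add inner_commute power2_norm_eq_inner)
qed

text \<open>
  A linear bound at all the gradients passes to their convex combination \<open>-s\<close>, without naming
  its coefficients.
\<close>

lemma inner_minus_descent_field_le:
  assumes "q \<ge> 1" and "\<And>i. i \<in> {1..q} \<Longrightarrow> inner w (grad (f i) x) \<le> R"
  shows "inner w (- descent_field q f x) \<le> R"
proof -
  have "co_grad q f x \<subseteq> {y. inner w y \<le> R}"
    unfolding co_grad_def using assms(2) by (intro hull_minimal convex_halfspace_le) auto
  then show ?thesis using minus_descent_field(1)[OF assms(1)] by blast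
qed

lemma Lip_finite_bound:
  assumes "ennreal m * Lip \<phi> A < ennreal c" "m > 0"
  obtains L where "m * L < c" "\<And>x y. x \<in> A \<Longrightarrow> y \<in> A \<Longrightarrow> norm (\<phi> x - \<phi> y) \<le> L * norm (x - y)"
proof -
  have "Lip \<phi> A < top"
    using assms by (cases "Lip \<phi> A") (auto simp: ennreal_mult_top)
  then obtain L where L: "Lip \<phi> A = ennreal L" "L \<ge> 0"
    by (cases "Lip \<phi> A") auto
  show thesis
  proof
    show "m * L < c"
      using assms L by (auto simp flip: ennreal_mult simp: ennreal_less_iff)
    fix x y assume xy: "x \<in> A" "y \<in> A"
    show "norm (\<phi> x - \<phi> y) \<le> L * norm (x - y)"
    proof (cases "x = y")
      case False
      have "ennreal (norm (\<phi> x - \<phi> y) / norm (x - y)) \<le> Lip \<phi> A"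
        unfolding Lip_def using xy False by (intro SUP_upper2[of "(x, y)"]) auto
      then show ?thesis
        using L False by (simp add: ennreal_le_iff divide_le_eq)
    qed simp
  qed
qed

section \<open>Lyapunov functions along a trajectory\<close>

text \<open>
  The data of a bounded trajectory on the open interval, with \<open>v\<close> and \<open>a\<close> as explicit first and
  second derivatives and the supremum \<open>Lip\<close> replaced by real Lipschitz constants \<open>L i\<close>.
\<close>

locale inertial_trajectory =
  fixes f :: "nat \<Rightarrow> 'a::{real_inner, complete_space} \<Rightarrow> real"
    and q :: nat and m \<gamma> t0 :: real and u v a :: "real \<Rightarrow> 'a" and L :: "nat \<Rightarrow> real"
  assumes q: "q \<ge> 1" and m: "m > 0" and \<gamma>: "\<gamma> > 0"
    and gderiv: "i \<in> {1..q} \<Longrightarrow> GDERIV (f i) x :> grad (f i) x"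
    and grad_continuous: "i \<in> {1..q} \<Longrightarrow> continuous_on UNIV (grad (f i))"
    and convex: "i \<in> {1..q} \<Longrightarrow> convex_on UNIV (f i)"
    and velocity: "t > t0 \<Longrightarrow> (u has_vector_derivative v t) (at t)"
    and acceleration: "t > t0 \<Longrightarrow> (v has_vector_derivative a t) (at t)"
    and ode: "t > t0 \<Longrightarrow> m *\<^sub>R a t = - \<gamma> *\<^sub>R v t + descent_field q f (u t)"
    and bounded_trajectory: "bounded (u ` {t0<..})"
    and grad_Lipschitz: "i \<in> {1..q} \<Longrightarrow> s > t0 \<Longrightarrow> t > t0 \<Longrightarrow>
      norm (grad (f i) (u s) - grad (f i) (u t)) \<le> L i * norm (u s - u t)"
    and damping: "i \<in> {1..q} \<Longrightarrow> m * L i < \<gamma>\<^sup>2"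
begin

definition energy :: "nat \<Rightarrow> real \<Rightarrow> real" where
  "energy i t = \<gamma> * f i (u t) + m * inner (grad (f i) (u t)) (v t) + m * \<gamma> * (norm (v t))\<^sup>2"

lemma f_continuous: "i \<in> {1..q} \<Longrightarrow> continuous_on UNIV (f i)"
  by (intro continuous_at_imp_continuous_on ballI
      has_derivative_continuous[OF gderiv[unfolded gderiv_def]])

lemma u_continuous: "continuous_on {t0<..} u"
  by (intro continuous_at_imp_continuous_on ballI has_vector_derivative_continuous[OF velocity]) simp

lemma v_continuous: "continuous_on {t0<..} v"
  by (intro continuous_at_imp_continuous_on ballI has_vector_derivative_continuous[OF acceleration])
    simp

lemma energy_continuous: "i \<in> {1..q} \<Longrightarrow> continuous_on {t0<..} (energy i)"
  unfolding energy_def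
  by (intro continuous_intros u_continuous v_continuous
      continuous_on_compose2[OF f_continuous u_continuous]
      continuous_on_compose2[OF grad_continuous u_continuous]) auto

lemma difference_quotient_tendsto:
  fixes w :: "real \<Rightarrow> 'b::real_normed_vector"
  assumes "(w has_vector_derivative d) (at t)"
  shows "((\<lambda>s. (w s - w t) /\<^sub>R (s - t)) \<longlongrightarrow> d) (at_right t)"
proof -
  have "((\<lambda>s. ((w s - w t) - (s - t) *\<^sub>R d) /\<^sub>R norm (s - t)) \<longlongrightarrow> 0) (at_right t)"
    using has_vector_derivative_at_within[OF assms, of "{t<..}"]
    unfolding has_vector_derivative_def has_derivative_at_within by blast
  from tendsto_add[OF this tendsto_const[of d]]
  have "((\<lambda>s. ((w s - w t) - (s - t) *\<^sub>R d) /\<^sub>R norm (s - t) + d) \<longlongrightarrow> d) (at_right t)"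
    by simp
  moreover have "\<forall>\<^sub>F s in at_right t. ((w s - w t) - (s - t) *\<^sub>R d) /\<^sub>R norm (s - t) + d
      = (w s - w t) /\<^sub>R (s - t)"
    using eventually_at_right_less[of t]
    by eventually_elim (simp add: scaleR_diff_right[of _ _ "_ *\<^sub>R d"])
  ultimately show ?thesis by (rule Lim_transform_eventually)
qed

lemma f_along_trajectory:
  assumes "i \<in> {1..q}" "t > t0"
  shows "((\<lambda>s. f i (u s)) has_real_derivative inner (grad (f i) (u t)) (v t)) (at t)"
proof -
  have "((\<lambda>s. f i (u s)) has_derivative (\<lambda>h. inner (h *\<^sub>R v t) (grad (f i) (u t)))) (at t)"
    using has_derivative_compose[OF velocity[OF assms(2), unfolded has_vector_derivative_def]
        gderiv[OF assms(1), unfolded gderiv_def]] .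
  then show ?thesis
    unfolding has_field_derivative_def
    by (rule has_derivative_eq_rhs) (simp add: fun_eq_iff inner_commute mult.commute)
qed

lemma norm_v_power2_derivative:
  assumes "t > t0"
  shows "((\<lambda>s. (norm (v s))\<^sup>2) has_real_derivative 2 * inner (v t) (a t)) (at t)"
proof -
  have "((\<lambda>s. inner (v s) (v s)) has_derivative
      (\<lambda>h. inner (v t) (h *\<^sub>R a t) + inner (h *\<^sub>R a t) (v t))) (at t)"
    using acceleration[OF assms] unfolding has_vector_derivative_def
    by (intro has_derivative_inner)
  then show ?thesis
    unfolding has_field_derivative_def power2_norm_eq_inner
    by (rule has_derivative_eq_rhs) (auto simp: inner_commute)
qed

text \<open>
  The product rule for \<open>\<langle>\<nabla>f\<^sub>i(u), v\<rangle>\<close>, with the derivative of the first factor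
  replaced by its bound \<open>L\<^sub>i \<parallel>v\<parallel>\<close>.
\<close>

lemma upper_dini_grad_velocity:
  assumes i: "i \<in> {1..q}" and t: "t > t0"
  shows "upper_dini_le (\<lambda>s. inner (grad (f i) (u s)) (v s)) t
    (inner (grad (f i) (u t)) (a t) + L i * (norm (v t))\<^sup>2)"
proof (rule upper_dini_leI)
  let ?G = "\<lambda>s. grad (f i) (u s)"
  let ?du = "\<lambda>s. (u s - u t) /\<^sub>R (s - t)" and ?dv = "\<lambda>s. (v s - v t) /\<^sub>R (s - t)"
  have "isCont ?G t"
  proof (rule isCont_o2[where g="grad (f i)"])
    show "isCont u t" by (rule has_vector_derivative_continuous[OF velocity[OF t]])
    show "isCont (grad (f i)) (u t)"
      using grad_continuous[OF i] by (simp add: continuous_on_eq_continuous_at)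
  qed
  then have "(?G \<longlongrightarrow> ?G t) (at_right t)"
    unfolding isCont_def by (rule tendsto_within_subset) simp
  then have "((\<lambda>s. inner (?G s) (?dv s) + L i * (norm (?du s) * norm (v t))) \<longlongrightarrow>
      inner (?G t) (a t) + L i * (norm (v t) * norm (v t))) (at_right t)"
    by (intro tendsto_intros difference_quotient_tendsto velocity acceleration t)
  then show "((\<lambda>s. inner (?G s) (?dv s) + L i * (norm (?du s) * norm (v t))) \<longlongrightarrow>
      inner (?G t) (a t) + L i * (norm (v t))\<^sup>2) (at_right t)"
    by (simp add: power2_eq_square)
  fix s assume s: "s > t"
  have "inner (?G s) (v s) - inner (?G t) (v t)
      = inner (?G s) (v s - v t) + inner (?G s - ?G t) (v t)"
    by (simp add: inner_diff)
  also have "inner (?G s - ?G t) (v t) \<le> norm (?G s - ?G t) * norm (v t)"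
    by (rule norm_cauchy_schwarz)
  also have "\<dots> \<le> L i * norm (u s - u t) * norm (v t)"
    using grad_Lipschitz[OF i, of s t] s t by (intro mult_right_mono) auto
  also have "inner (?G s) (v s - v t) + L i * norm (u s - u t) * norm (v t)
      = (s - t) * (inner (?G s) (?dv s) + L i * (norm (?du s) * norm (v t)))"
  proof -
    have 1: "inner (?G s) (v s - v t) = (s - t) * inner (?G s) (?dv s)"
      using s by simp
    have 2: "L i * norm (u s - u t) * norm (v t) = (s - t) * (L i * (norm (?du s) * norm (v t)))"
      using s by simp
    show ?thesis
      by (subst distrib_left) (rule arg_cong2[where f="(+)", OF 1 2])
  qed
  finally show "inner (?G s) (v s) - inner (?G t) (v t)
      \<le> (s - t) * (inner (?G s) (?dv s) + L i * (norm (?du s) * norm (v t)))" by simp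
qed

text \<open>
  Substituting \<open>s = m a + \<gamma> v\<close> in \<open>\<langle>\<nabla>f\<^sub>i(u), s\<rangle> \<le> -\<parallel>s\<parallel>\<^sup>2\<close> bounds
  \<open>\<gamma> \<langle>\<nabla>f\<^sub>i(u), v\<rangle> + m \<langle>\<nabla>f\<^sub>i(u), a\<rangle>\<close>, the derivative of \<open>\<gamma> f\<^sub>i(u) + m \<langle>\<nabla>f\<^sub>i(u), v\<rangle>\<close> up to the
  error \<open>m L\<^sub>i \<parallel>v\<parallel>\<^sup>2\<close>; the term \<open>m \<gamma> \<parallel>v\<parallel>\<^sup>2\<close> of the energy cancels the cross term
  \<open>-2 m \<gamma> \<langle>v, a\<rangle>\<close> of \<open>-\<parallel>s\<parallel>\<^sup>2\<close>.
\<close>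

lemma upper_dini_energy:
  assumes i: "i \<in> {1..q}" and t: "t > t0"
  shows "upper_dini_le (energy i) t (- (m\<^sup>2 * (norm (a t))\<^sup>2 + (\<gamma>\<^sup>2 - m * L i) * (norm (v t))\<^sup>2))"
proof -
  let ?g = "grad (f i) (u t)" and ?s = "descent_field q f (u t)"
  have "upper_dini_le (energy i) t (\<gamma> * inner ?g (v t)
      + m * (inner ?g (a t) + L i * (norm (v t))\<^sup>2) + m * \<gamma> * (2 * inner (v t) (a t)))"
    unfolding energy_def using m \<gamma>
    by (intro upper_dini_le_add upper_dini_le_cmult upper_dini_grad_velocity i t
        has_derivative_upper_dini_le f_along_trajectory norm_v_power2_derivative) auto
  moreover have s: "?s = m *\<^sub>R a t + \<gamma> *\<^sub>R v t" using ode[OF t] by simp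
  have "inner ?g ?s \<le> - inner ?s ?s"
    using inner_grad_descent_field_le[OF i] by (simp add: power2_norm_eq_inner)
  then have "m * inner ?g (a t) + \<gamma> * inner ?g (v t)
      \<le> - (m\<^sup>2 * (norm (a t))\<^sup>2 + 2 * m * \<gamma> * inner (v t) (a t) + \<gamma>\<^sup>2 * (norm (v t))\<^sup>2)"
    unfolding s power2_norm_eq_inner
    by (simp add: inner_add inner_commute power2_eq_square algebra_simps)
  then have "\<gamma> * inner ?g (v t) + m * (inner ?g (a t) + L i * (norm (v t))\<^sup>2)
      + m * \<gamma> * (2 * inner (v t) (a t))
      \<le> - (m\<^sup>2 * (norm (a t))\<^sup>2 + (\<gamma>\<^sup>2 - m * L i) * (norm (v t))\<^sup>2)"
    by (simp add: algebra_simps)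
  ultimately show ?thesis by (rule_tac upper_dini_le_mono)
qed

lemma gradient_bounded:
  assumes i: "i \<in> {1..q}"
  obtains K where "\<And>t. t > t0 \<Longrightarrow> norm (grad (f i) (u t)) \<le> K"
proof -
  define t1 where "t1 = t0 + 1"
  let ?g = "grad (f i)"
  obtain R where R: "\<And>t. t > t0 \<Longrightarrow> norm (u t) \<le> R"
    using bounded_trajectory by (auto simp: bounded_iff)
  have diff: "norm (u t - u t1) \<le> 2 * R" if "t > t0" for t
    using R[of t] R[of t1] that norm_triangle_ineq4[of "u t" "u t1"] by (simp add: t1_def)
  define K where "K = norm (?g (u t1)) + \<bar>L i\<bar> * (2 * R)"
  have g: "norm (?g (u t)) \<le> K" if "t > t0" for t
  proof -
    have "norm (?g (u t)) \<le> norm (?g (u t1)) + norm (?g (u t) - ?g (u t1))"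
      using norm_triangle_ineq[of "?g (u t1)" "?g (u t) - ?g (u t1)"] by simp
    also have "norm (?g (u t) - ?g (u t1)) \<le> L i * norm (u t - u t1)"
      using grad_Lipschitz[OF i] that by (simp add: t1_def)
    also have "\<dots> \<le> \<bar>L i\<bar> * (2 * R)"
      using diff[OF that] by (intro mult_mono) auto
    finally show ?thesis by (simp add: K_def)
  qed
  then show thesis using that by blast
qed

text \<open>
  The tangent at one point bounds \<open>f\<^sub>i\<close> below on the bounded trajectory, and the quadratic term
  in \<open>v\<close> absorbs \<open>m \<langle>\<nabla>f\<^sub>i(u), v\<rangle>\<close> because the gradient is bounded there.
\<close>

lemma energy_bounded_below:
  assumes i: "i \<in> {1..q}"
  obtains B where "\<And>t. t > t0 \<Longrightarrow> B \<le> energy i t"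
proof -
  define t1 where "t1 = t0 + 1"
  let ?g = "grad (f i)"
  obtain R where R: "\<And>t. t > t0 \<Longrightarrow> norm (u t) \<le> R"
    using bounded_trajectory by (auto simp: bounded_iff)
  have diff: "norm (u t - u t1) \<le> 2 * R" if "t > t0" for t
    using R[of t] R[of t1] that norm_triangle_ineq4[of "u t" "u t1"] by (simp add: t1_def)
  obtain K where g: "\<And>t. t > t0 \<Longrightarrow> norm (?g (u t)) \<le> K"
    using gradient_bounded[OF i] by blast
  define B where "B = \<gamma> * (f i (u t1) - norm (?g (u t1)) * (2 * R)) - m * K\<^sup>2 / (4 * \<gamma>)"
  have "B \<le> energy i t" if t: "t > t0" for t
  proof -
    have "- inner (?g (u t1)) (u t - u t1) \<le> norm (?g (u t1)) * norm (u t - u t1)"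
      using Cauchy_Schwarz_ineq2[of "?g (u t1)" "u t - u t1"] by linarith
    also have "\<dots> \<le> norm (?g (u t1)) * (2 * R)"
      using diff[OF t] by (intro mult_left_mono) auto
    finally have "f i (u t1) - norm (?g (u t1)) * (2 * R) \<le> f i (u t)"
      using convex_above_tangent[OF convex[OF i] gderiv[OF i], of "u t1" "u t"] by linarith
    then have 1: "\<gamma> * (f i (u t1) - norm (?g (u t1)) * (2 * R)) \<le> \<gamma> * f i (u t)"
      using \<gamma> by (intro mult_left_mono) auto
    have "- inner (?g (u t)) (v t) \<le> norm (?g (u t)) * norm (v t)"
      using Cauchy_Schwarz_ineq2[of "?g (u t)" "v t"] by linarith
    also have "\<dots> \<le> K * norm (v t)"
      using g[OF t] by (intro mult_right_mono) auto
    also have "\<dots> \<le> \<gamma> * (norm (v t))\<^sup>2 + K\<^sup>2 / (4 * \<gamma>)"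
    proof -
      have "0 \<le> (2 * \<gamma> * norm (v t) - K)\<^sup>2 / (4 * \<gamma>)" using \<gamma> by simp
      also have "\<dots> = \<gamma> * (norm (v t))\<^sup>2 + K\<^sup>2 / (4 * \<gamma>) - K * norm (v t)"
        using \<gamma> by (simp add: field_simps power2_eq_square)
      finally show ?thesis by simp
    qed
    finally have "m * (- inner (?g (u t)) (v t)) \<le> m * (\<gamma> * (norm (v t))\<^sup>2 + K\<^sup>2 / (4 * \<gamma>))"
      using m by (intro mult_left_mono) auto
    with 1 show ?thesis
      by (simp add: B_def energy_def algebra_simps)
  qed
  then show thesis using that by blast
qed

lemma energy_convergent:
  assumes i: "i \<in> {1..q}"
  obtains l where "(energy i \<longlongrightarrow> l) at_top" "\<And>t. t > t0 \<Longrightarrow> l \<le> energy i t"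
proof -
  obtain B where "\<And>t. t > t0 \<Longrightarrow> B \<le> energy i t" using energy_bounded_below[OF i] by blast
  moreover have "upper_dini_le (energy i) t 0" if "t > t0" for t
  proof (rule upper_dini_le_mono[OF upper_dini_energy[OF i that]])
    have "0 \<le> m\<^sup>2 * (norm (a t))\<^sup>2 + (\<gamma>\<^sup>2 - m * L i) * (norm (v t))\<^sup>2"
      using damping[OF i] by (intro add_nonneg_nonneg mult_nonneg_nonneg) auto
    then show "- (m\<^sup>2 * (norm (a t))\<^sup>2 + (\<gamma>\<^sup>2 - m * L i) * (norm (v t))\<^sup>2) \<le> 0"
      by linarith
  qed
  ultimately show thesis
    using converges_if_upper_dini_le_0[OF energy_continuous[OF i]] that by blast
qed

text \<open>
  The derivative \<open>2 \<langle>v, a\<rangle>\<close> of \<open>\<parallel>v\<parallel>\<^sup>2\<close> is at most a multiple of the dissipation of the energy, so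
  \<open>\<parallel>v\<parallel>\<^sup>2 + k W\<^sub>1\<close> is nonincreasing for large \<open>k\<close>, and \<open>\<parallel>v\<parallel>\<^sup>2\<close> converges.  A positive limit would
  make \<open>W\<^sub>1\<close> decrease at a fixed rate for ever.
\<close>

lemma velocity_tendsto_0: "((\<lambda>t. norm (v t)) \<longlongrightarrow> 0) at_top"
proof -
  have i: "1 \<in> {1..q}" using q by simp
  define c where "c = \<gamma>\<^sup>2 - m * L 1"
  have c: "c > 0" using damping[OF i] by (simp add: c_def)
  obtain E where E: "(energy 1 \<longlongrightarrow> E) at_top" "\<And>t. t > t0 \<Longrightarrow> E \<le> energy 1 t"
    using energy_convergent[OF i] by blast
  \<comment> \<open>The two summands make \<open>k m\<^sup>2 \<ge> 1\<close> and \<open>k c \<ge> 1\<close>, which is what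
    \<open>\<parallel>v\<parallel>\<^sup>2 + \<parallel>a\<parallel>\<^sup>2 \<le> k (m\<^sup>2 \<parallel>a\<parallel>\<^sup>2 + c \<parallel>v\<parallel>\<^sup>2)\<close> needs.\<close>
  define k where "k = 1 / m\<^sup>2 + 1 / c"
  have k: "k > 0" using m c by (simp add: k_def add_pos_pos)
  let ?F = "\<lambda>t. (norm (v t))\<^sup>2 + k * energy 1 t"
  have "upper_dini_le ?F t 0" if t: "t > t0" for t
  proof (rule upper_dini_le_mono)
    show "upper_dini_le ?F t (2 * inner (v t) (a t)
        + k * - (m\<^sup>2 * (norm (a t))\<^sup>2 + c * (norm (v t))\<^sup>2))"
      unfolding c_def
      by (intro upper_dini_le_add upper_dini_le_cmult upper_dini_energy i t k
          has_derivative_upper_dini_le norm_v_power2_derivative)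
    have "2 * inner (v t) (a t) \<le> (norm (v t))\<^sup>2 + (norm (a t))\<^sup>2"
      using inner_ge_zero[of "v t - a t"]
      by (simp add: power2_norm_eq_inner inner_diff inner_commute)
    also have "\<dots> \<le> k * (m\<^sup>2 * (norm (a t))\<^sup>2 + c * (norm (v t))\<^sup>2)"
    proof -
      have "k * (m\<^sup>2 * (norm (a t))\<^sup>2 + c * (norm (v t))\<^sup>2)
          = (norm (v t))\<^sup>2 + (norm (a t))\<^sup>2
            + (m\<^sup>2 / c * (norm (a t))\<^sup>2 + c / m\<^sup>2 * (norm (v t))\<^sup>2)"
        using m c by (simp add: k_def field_simps)
      moreover have "0 \<le> m\<^sup>2 / c * (norm (a t))\<^sup>2 + c / m\<^sup>2 * (norm (v t))\<^sup>2"
        using c by (intro add_nonneg_nonneg mult_nonneg_nonneg) auto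
      ultimately show ?thesis by linarith
    qed
    finally show "2 * inner (v t) (a t) + k * - (m\<^sup>2 * (norm (a t))\<^sup>2 + c * (norm (v t))\<^sup>2) \<le> 0"
      unfolding mult_minus_right by linarith
  qed
  moreover have "continuous_on {t0<..} ?F"
    by (intro continuous_intros v_continuous energy_continuous i)
  moreover have "k * E \<le> ?F t" if "t > t0" for t
    using mult_left_mono[OF E(2)[OF that], of k] k by (simp add: add_increasing)
  ultimately obtain l where "(?F \<longlongrightarrow> l) at_top"
    using converges_if_upper_dini_le_0[of t0 ?F "k * E"] by blast
  then have "((\<lambda>t. ?F t - k * energy 1 t) \<longlongrightarrow> l - k * E) at_top"
    by (intro tendsto_intros E(1))
  then obtain h where lim: "((\<lambda>t. (norm (v t))\<^sup>2) \<longlongrightarrow> h) at_top" by auto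
  moreover have "h = 0"
  proof (rule ccontr)
    assume ne: "h \<noteq> 0"
    have "0 \<le> h" using lim by (rule tendsto_lowerbound) auto
    with ne have pos: "h > 0" by simp
    then have "h / 2 < h" by linarith
    then have "\<forall>\<^sub>F t in at_top. h / 2 < (norm (v t))\<^sup>2"
      by (rule order_tendstoD(1)[OF lim])
    then obtain T where T: "\<And>t. t \<ge> T \<Longrightarrow> h / 2 < (norm (v t))\<^sup>2"
      by (auto simp: eventually_at_top_linorder)
    show False
    proof (rule unbounded_below_if_upper_dini_le_neg[where F="energy 1" and a="max T t0"
          and d="c * (h / 2)" and B=E])
      show "continuous_on {max T t0<..} (energy 1)"
        by (rule continuous_on_subset[OF energy_continuous[OF i]]) auto
      show "c * (h / 2) > 0" using c pos by simp
      fix t assume t: "t > max T t0"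
      then show "E \<le> energy 1 t" using E(2) by simp
      have "c * (h / 2) \<le> c * (norm (v t))\<^sup>2"
        using T[of t] t c by (intro mult_left_mono) auto
      then have "c * (h / 2) \<le> m\<^sup>2 * (norm (a t))\<^sup>2 + c * (norm (v t))\<^sup>2"
        by (simp add: add_increasing)
      then have "- (m\<^sup>2 * (norm (a t))\<^sup>2 + (\<gamma>\<^sup>2 - m * L 1) * (norm (v t))\<^sup>2) \<le> - (c * (h / 2))"
        unfolding c_def by linarith
      then show "upper_dini_le (energy 1) t (- (c * (h / 2)))"
        using t by (intro upper_dini_le_mono[OF upper_dini_energy[OF i]]) auto
    qed
  qed
  ultimately have "((\<lambda>t. sqrt ((norm (v t))\<^sup>2)) \<longlongrightarrow> sqrt 0) at_top"
    by (intro tendsto_real_sqrt) simp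
  then show ?thesis by simp
qed

lemma inner_velocity_tendsto_0:
  assumes "\<And>t. t > t0 \<Longrightarrow> norm (w t) \<le> K"
  shows "((\<lambda>t. inner (w t) (v t)) \<longlongrightarrow> 0) at_top"
proof (rule Lim_null_comparison)
  show "((\<lambda>t. K * norm (v t)) \<longlongrightarrow> 0) at_top"
    using tendsto_mult_right_zero[OF velocity_tendsto_0] .
  show "\<forall>\<^sub>F t in at_top. norm (inner (w t) (v t)) \<le> K * norm (v t)"
    using eventually_gt_at_top[of t0]
  proof eventually_elim
    case (elim t)
    have "norm (inner (w t) (v t)) \<le> norm (w t) * norm (v t)"
      using Cauchy_Schwarz_ineq2 by simp
    also have "\<dots> \<le> K * norm (v t)"
      using assms[OF elim] by (rule mult_right_mono) simp
    finally show ?case .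
  qed
qed

lemma displacement_velocity_tendsto_0: "((\<lambda>t. inner (u t - z) (v t)) \<longlongrightarrow> 0) at_top"
proof -
  obtain R where R: "\<And>t. t > t0 \<Longrightarrow> norm (u t) \<le> R"
    using bounded_trajectory by (auto simp: bounded_iff)
  show ?thesis
  proof (rule inner_velocity_tendsto_0)
    show "norm (u t - z) \<le> R + norm z" if "t > t0" for t
      using R[OF that] norm_triangle_ineq4[of "u t" z] by linarith
  qed
qed

text \<open>
  Since \<open>v \<longlongrightarrow> 0\<close> and the gradients are bounded, \<open>W\<^sub>i\<close> and \<open>\<gamma> f\<^sub>i(u)\<close> have the same limit; the
  lower bound holds because \<open>W\<^sub>i\<close> decreases to its limit.
\<close>

lemma f_convergent:
  assumes i: "i \<in> {1..q}"
  obtains c where "((\<lambda>t. f i (u t)) \<longlongrightarrow> c) at_top" "\<And>t. t > t0 \<Longrightarrow> \<gamma> * c \<le> energy i t"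
proof -
  obtain l where l: "(energy i \<longlongrightarrow> l) at_top" "\<And>t. t > t0 \<Longrightarrow> l \<le> energy i t"
    using energy_convergent[OF i] by blast
  obtain K where K: "\<And>t. t > t0 \<Longrightarrow> norm (grad (f i) (u t)) \<le> K"
    using gradient_bounded[OF i] by blast
  have "((\<lambda>t. (energy i t - m * inner (grad (f i) (u t)) (v t) - m * \<gamma> * (norm (v t))\<^sup>2) / \<gamma>)
      \<longlongrightarrow> (l - m * 0 - m * \<gamma> * 0\<^sup>2) / \<gamma>) at_top"
    using \<gamma> by (intro tendsto_intros l(1) inner_velocity_tendsto_0[OF K] velocity_tendsto_0) auto
  then have "((\<lambda>t. f i (u t)) \<longlongrightarrow> l / \<gamma>) at_top"
    using \<gamma> by (simp add: energy_def)
  then show thesis using l(2) \<gamma> that[of "l / \<gamma>"] by simp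
qed

definition f_limit :: "nat \<Rightarrow> real" where
  "f_limit i = Lim at_top (\<lambda>t. f i (u t))"

lemma f_limit:
  assumes i: "i \<in> {1..q}"
  shows "((\<lambda>t. f i (u t)) \<longlongrightarrow> f_limit i) at_top"
    and "t > t0 \<Longrightarrow> \<gamma> * f_limit i \<le> energy i t"
proof -
  obtain c where c: "((\<lambda>t. f i (u t)) \<longlongrightarrow> c) at_top" "\<And>t. t > t0 \<Longrightarrow> \<gamma> * c \<le> energy i t"
    using f_convergent[OF i] by blast
  moreover have "f_limit i = c"
    unfolding f_limit_def by (rule tendsto_Lim[OF _ c(1)]) simp
  ultimately show "((\<lambda>t. f i (u t)) \<longlongrightarrow> f_limit i) at_top"
    and "t > t0 \<Longrightarrow> \<gamma> * f_limit i \<le> energy i t" by simp_all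
qed

text \<open>
  With \<open>h = \<parallel>u - z\<parallel>\<^sup>2 / 2\<close> the first two terms are \<open>m h' + \<gamma> h\<close>.  The last two
  compensate the terms \<open>m \<parallel>v\<parallel>\<^sup>2\<close> and \<open>-(m\<^sup>2/\<gamma>) \<langle>v, a\<rangle>\<close> in the bound for its derivative.  Any
  index in \<open>{1..q}\<close> would do in place of \<open>1\<close>.
\<close>

definition anchored_energy :: "'a \<Rightarrow> real \<Rightarrow> real" where
  "anchored_energy z t = m * inner (u t - z) (v t) + \<gamma> / 2 * (norm (u t - z))\<^sup>2
     + m\<^sup>2 / (2 * \<gamma>) * (norm (v t))\<^sup>2 + m / (\<gamma>\<^sup>2 - m * L 1) * energy 1 t"

lemma anchored_energy_continuous: "continuous_on {t0<..} (anchored_energy z)"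
  unfolding anchored_energy_def
  by (intro continuous_intros u_continuous v_continuous energy_continuous) (use q in simp)

text \<open>
  By the equation of motion, \<open>m h'' + \<gamma> h' = m \<parallel>v\<parallel>\<^sup>2 + \<langle>s, u - z\<rangle>\<close>.  For each \<open>i\<close>, convexity and
  \<open>\<gamma> f\<^sub>i\<^sup>* \<le> W\<^sub>i\<close> give \<open>\<langle>\<nabla>f\<^sub>i(u), z - u\<rangle> \<le> f\<^sub>i\<^sup>* - d - f\<^sub>i(u) \<le> (m/\<gamma>) \<langle>\<nabla>f\<^sub>i(u), v\<rangle> + m \<parallel>v\<parallel>\<^sup>2 - d\<close>,
  which passes to \<open>-s\<close>.  After substituting \<open>s = m a + \<gamma> v\<close> the remaining inner product is
  \<open>-(m\<^sup>2/\<gamma>) \<langle>v, a\<rangle>\<close>, a total derivative, and the remaining \<open>m \<parallel>v\<parallel>\<^sup>2\<close> is paid for by the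
  dissipation of \<open>W\<^sub>1\<close>.
\<close>

lemma upper_dini_anchored_energy:
  assumes z: "\<And>i. i \<in> {1..q} \<Longrightarrow> f i z \<le> f_limit i - d" and t: "t > t0"
  shows "upper_dini_le (anchored_energy z) t (- d)"
proof (rule upper_dini_le_mono)
  let ?s = "descent_field q f (u t)"
  let ?W = "m\<^sup>2 * (norm (a t))\<^sup>2 + (\<gamma>\<^sup>2 - m * L 1) * (norm (v t))\<^sup>2"
  let ?r = "m * (inner (u t - z) (a t) + (norm (v t))\<^sup>2) + \<gamma> / 2 * (2 * inner (u t - z) (v t))
      + m\<^sup>2 / (2 * \<gamma>) * (2 * inner (v t) (a t))"
  have one: "1 \<in> {1..q}" using q by simp
  have c: "\<gamma>\<^sup>2 - m * L 1 > 0" using damping[OF one] by simp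
  have du: "((\<lambda>s. u s - z) has_derivative (\<lambda>h. h *\<^sub>R v t)) (at t)"
    using velocity[OF t] unfolding has_vector_derivative_def
    by (auto intro!: derivative_eq_intros)
  have dv: "(v has_derivative (\<lambda>h. h *\<^sub>R a t)) (at t)"
    using acceleration[OF t] unfolding has_vector_derivative_def .
  have 1: "((\<lambda>s. inner (u s - z) (v s)) has_real_derivative
      inner (u t - z) (a t) + (norm (v t))\<^sup>2) (at t)"
    unfolding has_field_derivative_def
    by (rule has_derivative_eq_rhs[OF has_derivative_inner[OF du dv]])
      (simp add: fun_eq_iff power2_norm_eq_inner algebra_simps)
  have 2: "((\<lambda>s. (norm (u s - z))\<^sup>2) has_real_derivative 2 * inner (u t - z) (v t)) (at t)"
    unfolding has_field_derivative_def power2_norm_eq_inner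
    by (rule has_derivative_eq_rhs[OF has_derivative_inner[OF du du]])
      (simp add: fun_eq_iff inner_commute)
  show "upper_dini_le (anchored_energy z) t (?r + m / (\<gamma>\<^sup>2 - m * L 1) * - ?W)"
    unfolding anchored_energy_def using m \<gamma> c
    by (intro upper_dini_le_add upper_dini_le_cmult upper_dini_energy one t
        has_derivative_upper_dini_le 1 2 norm_v_power2_derivative) auto
  have "inner (z - u t - (m / \<gamma>) *\<^sub>R v t) (- ?s) \<le> m * (norm (v t))\<^sup>2 - d"
  proof (rule inner_minus_descent_field_le[OF q])
    fix i assume i: "i \<in> {1..q}"
    let ?g = "grad (f i) (u t)"
    have "inner ?g (z - u t) \<le> f_limit i - d - f i (u t)"
      using convex_above_tangent[OF convex[OF i] gderiv[OF i], of "u t" z] z[OF i] by simp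
    moreover have "f_limit i \<le> f i (u t) + m / \<gamma> * inner ?g (v t) + m * (norm (v t))\<^sup>2"
      using f_limit(2)[OF i t] \<gamma> by (simp add: energy_def field_simps)
    ultimately show "inner (z - u t - (m / \<gamma>) *\<^sub>R v t) ?g \<le> m * (norm (v t))\<^sup>2 - d"
      by (simp add: inner_diff inner_commute)
  qed
  also have "inner (z - u t - (m / \<gamma>) *\<^sub>R v t) (- ?s) = inner (u t - z + (m / \<gamma>) *\<^sub>R v t) ?s"
    by (simp add: inner_add inner_diff)
  also have "?s = m *\<^sub>R a t + \<gamma> *\<^sub>R v t" using ode[OF t] by simp
  also have "inner (u t - z + (m / \<gamma>) *\<^sub>R v t) (m *\<^sub>R a t + \<gamma> *\<^sub>R v t) = ?r"
    using \<gamma> unfolding power2_norm_eq_inner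
    by (simp add: inner_add inner_diff power2_eq_square field_simps)
  finally have "?r \<le> m * (norm (v t))\<^sup>2 - d" .
  moreover have "m / (\<gamma>\<^sup>2 - m * L 1) * ?W \<ge> m * (norm (v t))\<^sup>2"
  proof -
    have "m / (\<gamma>\<^sup>2 - m * L 1) * ?W
        = m * (norm (v t))\<^sup>2 + m / (\<gamma>\<^sup>2 - m * L 1) * (m\<^sup>2 * (norm (a t))\<^sup>2)"
      using c by (simp add: distrib_left)
    then show ?thesis using m c by simp
  qed
  ultimately show "?r + m / (\<gamma>\<^sup>2 - m * L 1) * - ?W \<le> - d"
    unfolding mult_minus_right by linarith
qed

lemma anchored_energy_bounded_below:
  obtains B T where "T \<ge> t0" "\<And>t. t > T \<Longrightarrow> B \<le> anchored_energy z t"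
proof -
  have one: "1 \<in> {1..q}" using q by simp
  have c: "\<gamma>\<^sup>2 - m * L 1 > 0" using damping[OF one] by simp
  obtain B where B: "\<And>t. t > t0 \<Longrightarrow> B \<le> energy 1 t" using energy_bounded_below[OF one] by blast
  obtain T where T: "\<And>t. t \<ge> T \<Longrightarrow> -1 < inner (u t - z) (v t)"
    using order_tendstoD(1)[OF displacement_velocity_tendsto_0, of "-1" z]
    by (auto simp: eventually_at_top_linorder)
  show thesis
  proof
    show "max T t0 \<ge> t0" by simp
    fix t assume t: "t > max T t0"
    have "m * - 1 \<le> m * inner (u t - z) (v t)"
      using T[of t] t m by (intro mult_left_mono) auto
    moreover have "m / (\<gamma>\<^sup>2 - m * L 1) * B \<le> m / (\<gamma>\<^sup>2 - m * L 1) * energy 1 t"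
      using B[of t] t m c by (intro mult_left_mono) auto
    moreover have "0 \<le> \<gamma> / 2 * (norm (u t - z))\<^sup>2" "0 \<le> m\<^sup>2 / (2 * \<gamma>) * (norm (v t))\<^sup>2"
      using \<gamma> by auto
    ultimately show "m * - 1 + m / (\<gamma>\<^sup>2 - m * L 1) * B \<le> anchored_energy z t"
      unfolding anchored_energy_def by linarith
  qed
qed

lemma distance_convergent:
  assumes z: "\<And>i. i \<in> {1..q} \<Longrightarrow> f i z \<le> f_limit i"
  obtains l where "((\<lambda>t. (norm (u t - z))\<^sup>2) \<longlongrightarrow> l) at_top"
proof -
  have one: "1 \<in> {1..q}" using q by simp
  obtain B T where T: "T \<ge> t0" "\<And>t. t > T \<Longrightarrow> B \<le> anchored_energy z t"
    using anchored_energy_bounded_below by blast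
  have "continuous_on {T<..} (anchored_energy z)"
    using T(1) by (intro continuous_on_subset[OF anchored_energy_continuous]) auto
  moreover have "upper_dini_le (anchored_energy z) t 0" if "t > T" for t
    using upper_dini_anchored_energy[of z 0 t] z T(1) that by simp
  ultimately obtain l where l: "(anchored_energy z \<longlongrightarrow> l) at_top"
    using converges_if_upper_dini_le_0 T(2) by blast
  obtain E where E: "(energy 1 \<longlongrightarrow> E) at_top" using energy_convergent[OF one] by blast
  let ?c = "m / (\<gamma>\<^sup>2 - m * L 1)"
  have "((\<lambda>t. (anchored_energy z t - m * inner (u t - z) (v t) - m\<^sup>2 / (2 * \<gamma>) * (norm (v t))\<^sup>2
        - ?c * energy 1 t) / (\<gamma> / 2))
      \<longlongrightarrow> (l - m * 0 - m\<^sup>2 / (2 * \<gamma>) * 0\<^sup>2 - ?c * E) / (\<gamma> / 2)) at_top"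
    using \<gamma> by (intro tendsto_divide tendsto_diff tendsto_mult tendsto_power tendsto_const
        l E displacement_velocity_tendsto_0 velocity_tendsto_0) auto
  moreover have "(anchored_energy z t - m * inner (u t - z) (v t) - m\<^sup>2 / (2 * \<gamma>) * (norm (v t))\<^sup>2
        - ?c * energy 1 t) / (\<gamma> / 2) = (norm (u t - z))\<^sup>2" for t
    using \<gamma> by (simp add: anchored_energy_def)
  ultimately show thesis using that by auto
qed

text \<open>
  Otherwise the energy anchored at \<open>z\<close> would decrease at rate \<open>d\<close> for ever, although it is bounded
  below.
\<close>

lemma no_uniformly_better_point:
  assumes "d > 0"
  shows "\<exists>i\<in>{1..q}. f_limit i - d < f i z"
proof (rule ccontr)
  assume "\<not> ?thesis"
  then have z: "f i z \<le> f_limit i - d" if "i \<in> {1..q}" for i using that by force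
  obtain B T where T: "T \<ge> t0" "\<And>t. t > T \<Longrightarrow> B \<le> anchored_energy z t"
    using anchored_energy_bounded_below by blast
  show False
  proof (rule unbounded_below_if_upper_dini_le_neg)
    show "continuous_on {T<..} (anchored_energy z)"
      using T(1) by (intro continuous_on_subset[OF anchored_energy_continuous]) auto
    show "upper_dini_le (anchored_energy z) t (- d)" if "t > T" for t
      using upper_dini_anchored_energy[OF z] T(1) that by simp
  qed (use assms T(2) in auto)
qed

text \<open>
  Weak lower semicontinuity of the convex function \<open>f\<^sub>i\<close>: its sublevel sets just above the limit
  are closed, convex and contain a tail of the trajectory.
\<close>

lemma f_le_f_limit_on_asymptotic_hull:
  assumes i: "i \<in> {1..q}" and z: "z \<in> asymptotic_hull u"
  shows "f i z \<le> f_limit i"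
proof (rule field_le_epsilon)
  fix e :: real assume "e > 0"
  then have "\<forall>\<^sub>F t in at_top. f i (u t) < f_limit i + e"
    by (intro order_tendstoD(2)[OF f_limit(1)[OF i]]) simp
  then have "\<forall>\<^sub>F t in at_top. u t \<in> {x. f i x \<le> f_limit i + e}"
    by (auto elim: eventually_mono)
  moreover have "closed {x. f i x \<le> f_limit i + e}"
    using f_continuous[OF i] by (intro closed_Collect_le continuous_on_const)
  moreover have "convex {x. f i x \<le> f_limit i + e}"
    using convex_on_sublevel[OF convex[OF i]] .
  ultimately show "f i z \<le> f_limit i + e"
    using asymptotic_hull_subset z by blast
qed

lemma converges_weakly_to_weak_pareto_optimum:
  "\<exists>p. weak_pareto_optimum q f p \<and> converges_weakly u p at_top"
proof -
  obtain p where p: "p \<in> asymptotic_hull u" and conv: "converges_weakly u p at_top"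
  proof (rule converges_weakly_if_distances_converge[OF bounded_trajectory])
    show "\<exists>l. ((\<lambda>t. (norm (u t - z))\<^sup>2) \<longlongrightarrow> l) at_top" if "z \<in> asymptotic_hull u" for z
      using distance_convergent[of z] f_le_f_limit_on_asymptotic_hull that by metis
  qed
  have "weak_pareto_optimum q f p"
    unfolding weak_pareto_optimum_def
  proof
    assume "\<exists>z. \<forall>i\<in>{1..q}. f i z < f i p"
    then obtain z where z: "\<And>i. i \<in> {1..q} \<Longrightarrow> f i z < f i p" by blast
    define d where "d = Min ((\<lambda>i. f i p - f i z) ` {1..q})"
    have "d > 0" using q z by (auto simp: d_def)
    then obtain i where i: "i \<in> {1..q}" "f_limit i - d < f i z"
      using no_uniformly_better_point by blast
    have "d \<le> f i p - f i z" using i by (auto simp: d_def)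
    with i f_le_f_limit_on_asymptotic_hull[OF i(1) p] show False by linarith
  qed
  with conv show ?thesis by blast
qed

end

section \<open>Weak convergence to a weak Pareto optimum\<close>

theorem theorem4p7:
  fixes f :: "nat \<Rightarrow> 'a::{real_inner, complete_space} \<Rightarrow> real"
    and q :: nat
    and m \<gamma> t0 :: real
    and u0 v0 :: 'a
    and u :: "real \<Rightarrow> 'a"
  assumes "q \<ge> 1" and "m > 0" and "\<gamma> > 0"
    and "\<And>i. i \<in> {1..q} \<Longrightarrow> continuously_differentiable (f i)"
    and "\<And>i. i \<in> {1..q} \<Longrightarrow> lipschitz_on_bounded_sets (grad (f i))"
    and "\<And>i. i \<in> {1..q} \<Longrightarrow> convex_on UNIV (f i)"
    and "IMOG_solution m \<gamma> q f t0 \<infinity> u0 v0 u"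
    and "bounded (u ` {t0..})"
    and "\<And>i. i \<in> {1..q} \<Longrightarrow>
           ennreal (\<gamma>\<^sup>2) > ennreal m * Lip (grad (f i)) (u ` {t0..})"
  shows "\<exists>p. weak_pareto_optimum q f p \<and> converges_weakly u p at_top"
proof -
  have "\<exists>L. m * L < \<gamma>\<^sup>2 \<and> (\<forall>x\<in>u ` {t0..}. \<forall>y\<in>u ` {t0..}.
      norm (grad (f i) x - grad (f i) y) \<le> L * norm (x - y))" if "i \<in> {1..q}" for i
    using Lip_finite_bound[OF assms(9)[OF that] assms(2)] by metis
  then obtain L where L: "\<And>i. i \<in> {1..q} \<Longrightarrow> m * L i < \<gamma>\<^sup>2"
    "\<And>i s t. i \<in> {1..q} \<Longrightarrow> s \<ge> t0 \<Longrightarrow> t \<ge> t0 \<Longrightarrow>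
      norm (grad (f i) (u s) - grad (f i) (u t)) \<le> L i * norm (u s - u t)"
    by (metis atLeast_iff image_eqI)
  define v where "v t = vector_derivative u (at t)" for t
  define a where "a t = vector_derivative v (at t)" for t
  have "C2_differentiable_on u {t0<..}"
    and ode: "\<And>t. t > t0 \<Longrightarrow> m *\<^sub>R a t = - \<gamma> *\<^sub>R v t + descent_field q f (u t)"
    using assms(7) by (auto simp: IMOG_solution_def v_def[abs_def] a_def greaterThan_def)
  then have "(u has_vector_derivative v t) (at t)" "(v has_vector_derivative a t) (at t)"
    if "t > t0" for t
    using that unfolding C2_differentiable_on_def C1_differentiable_on_eq a_def
    by (simp_all add: v_def[abs_def] vector_derivative_works)
  then interpret inertial_trajectory f q m \<gamma> t0 u v a L
    using assms L ode
    by unfold_locales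
      (auto simp: continuously_differentiable_def intro: bounded_subset[of "u ` {t0..}"])
  show ?thesis by (rule converges_weakly_to_weak_pareto_optimum)
qed

end
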